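(* Let $\Phi:\mathbb{R}^n\to\mathbb{R}\cup\{+\infty\}$ be proper, lower semicontinuous and $\mu$-strongly convex for some $\mu\ge0$ ($\mu=0$ meaning convex), with nonempty set of minimizers $X_*$ and minimum value $\Phi_*$. Consider sequences generated by the FLOrA framework (defined in the context) applied to $\Phi$ with parameters $\mu$, $\sigma\in(0,1]$, $\lambda>0$, $\delta_0\ge0$, $\alpha$. Let $R_0:=\min\{\|x_0-x\|:x\in X_*\}$. Then for every $k\ge0$, $$\Phi(y_{k+1})-\Phi_*\le\frac{R_0^2}{2B_{k+1}}+\frac{\delta_0C}{B_{k+1}},$$ where $C:=\sum_{i=0}^\infty B_{i+1}\alpha^i<\infty$. Furthermore, if $\sigma<1$, then for every $k\ge0$, $$\|\tilde y_{k+1}-\tilde x_k\|\le\frac{\sqrt\lambda R_0+\sqrt{2\lambda\delta_0C}}{\sqrt{(1-\sigma)B_{k+1}}},\qquad \min_{0\le i\le k}\|\tilde y_{i+1}-\tilde x_i\|\le\frac{\sqrt\lambda R_0+\sqrt{2\lambda\delta_0C}}{\sqrt{(1-\sigma)\sum_{i=1}^{k+1}B_i}}.$$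
   Context: FLOrA framework for $\min_x\Phi(x)$. Input: $x_0\in\operatorname{dom}\Phi$, $\mu\ge0$, $\sigma\in(0,1]$, $\lambda>0$, $\delta_0\ge0$; $\tau_0=1$, $B_0=0$, $y_0=x_0$; $\alpha\ge0$ with $\alpha<(1+\sqrt{\lambda\mu})^{-2}$ (convention $0^0=1$). For $k=0,1,\dots$: 1. $\delta_k=\delta_0\alpha^k$, $b_k=\frac{\lambda\tau_k+\sqrt{\lambda^2\tau_k^2+4\lambda\tau_kB_k}}2$, $B_{k+1}=B_k+b_k$, $\tau_{k+1}=\tau_k+b_k\mu$, $\tilde x_k=\frac{B_k}{B_{k+1}}y_k+\frac{b_k}{B_{k+1}}x_k$. 2. Find $\tilde y_{k+1}\in\operatorname{dom}\Phi$ and a proper closed $(\mu+\lambda^{-1})$-strongly convex function $\Gamma_k$ (on $\operatorname{dom}\Phi$) such that $\Gamma_k(\cdot)\le\Phi(\cdot)+\frac1{2\lambda}\|\cdot-\tilde x_k\|^2$ and $$\|\lambda\hat u_{k+1}\|^2+2\lambda\Big[\Phi(\tilde y_{k+1})+\frac1{2\lambda}\|\tilde y_{k+1}-\tilde x_k\|^2-\Gamma_k(z_{k+1})\Big]\le\sigma\|\tilde y_{k+1}-\tilde x_k\|^2+2\lambda\delta_k,$$ where, for some $\mathcal A_k\in(0,\infty]$, $z_{k+1}=\operatorname{argmin}_{v\in\mathbb{R}^n}\{\Gamma_k(v)+\frac1{2\mathcal A_k}\|v-\tilde x_k\|^2\}$ and $\hat u_{k+1}=\frac{\tilde x_k-z_{k+1}}{\mathcal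 A_k}$ (with $1/\infty=0$). 3. Choose $y_{k+1}$ with $\Phi(y_{k+1})\le\Phi(\tilde y_{k+1})$ and set $u_{k+1}=\hat u_{k+1}+\frac{\tilde x_k-z_{k+1}}\lambda$, $x_{k+1}=\frac1{\tau_{k+1}}(\tau_kx_k+b_k\mu z_{k+1}-b_ku_{k+1})$. *)

theory Defs
  imports "HOL-Analysis.Analysis"
begin

definition edom :: "('a \<Rightarrow> ereal) \<Rightarrow> 'a set" where
  "edom f = {x. f x < \<infinity>}"

text \<open>Functions with values in the reals with \<open>+\<infinity>\<close> are modelled by type \<^typ>\<open>ereal\<close>;
  properness excludes the value \<open>-\<infinity>\<close>.\<close>

definition proper :: "('a \<Rightarrow> ereal) \<Rightarrow> bool" where
  "proper f \<longleftrightarrow> (\<forall>x. f x \<noteq> -\<infinity>) \<and> edom f \<noteq> {}"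

definition lower_semicontinuous :: "('a::topological_space \<Rightarrow> ereal) \<Rightarrow> bool" where
  "lower_semicontinuous f \<longleftrightarrow> (\<forall>x. f x \<le> Liminf (at x) f)"

definition closed_function :: "('a::topological_space \<Rightarrow> ereal) \<Rightarrow> bool" where
  "closed_function f \<longleftrightarrow> closed {(x, r :: real). f x \<le> ereal r}"

definition strongly_convex :: "real \<Rightarrow> ('a::real_normed_vector \<Rightarrow> ereal) \<Rightarrow> bool" where
  "strongly_convex m f \<longleftrightarrow>
     (\<forall>x\<in>edom f. \<forall>y\<in>edom f. \<forall>t\<in>{0..1}.
        f (t *\<^sub>R x + (1 - t) *\<^sub>R y)
          \<le> ereal t * f x + ereal (1 - t) * f y - ereal (m / 2 * t * (1 - t) * (norm (x - y))\<^sup>2))"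

definition minimizers :: "('a \<Rightarrow> ereal) \<Rightarrow> 'a set" where
  "minimizers f = {x. is_arg_min f (\<lambda>_. True) x}"

text \<open>
  The sequences generated by the FLOrA framework. The letters \<open>xt\<close> and \<open>yt\<close> stand for x and y with a
  tilde, and \<open>uh\<close> for u with a hat. The values of \<open>yt\<close>, \<open>z\<close>, \<open>uh\<close> and \<open>u\<close> at index 0 play no role.
  The prox parameters \<open>A k\<close> range over \<open>(0, \<infinity>]\<close>; in \<^typ>\<open>ereal\<close> one has \<open>1 / \<infinity> = 0\<close>.
  The models \<open>\<Gamma> k\<close> are extended-valued functions on the whole space, strongly convex as such; their
  domain contains that of \<open>\<Phi>\<close> because of \<open>Gamma_le\<close>, and functions given on the domain
  of \<open>\<Phi>\<close> only are covered by setting them to \<open>\<infinity>\<close> elsewhere.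
\<close>

locale FLOrA =
  fixes \<Phi> :: "real ^ 'n \<Rightarrow> ereal"
    and \<mu> \<sigma> lam \<delta>0 \<alpha> :: real
    and \<delta> b B \<tau> :: "nat \<Rightarrow> real"
    and x y xt yt z uh u :: "nat \<Rightarrow> real ^ 'n"
    and \<Gamma> :: "nat \<Rightarrow> real ^ 'n \<Rightarrow> ereal"
    and A :: "nat \<Rightarrow> ereal"
  assumes x_0: "x 0 \<in> edom \<Phi>"
    and mu: "\<mu> \<ge> 0"
    and sigma: "\<sigma> \<in> {0<..1}"
    and lambda: "lam > 0"
    and delta0: "\<delta>0 \<ge> 0"
    and alpha: "\<alpha> \<ge> 0" "\<alpha> < 1 / (1 + sqrt (lam * \<mu>))\<^sup>2"
    and tau_0: "\<tau> 0 = 1"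
    and B_0: "B 0 = 0"
    and y_0: "y 0 = x 0"
    and delta: "\<And>k. \<delta> k = \<delta>0 * \<alpha> ^ k"
    and b: "\<And>k. b k = (lam * \<tau> k + sqrt (lam\<^sup>2 * (\<tau> k)\<^sup>2 + 4 * lam * \<tau> k * B k)) / 2"
    and B_Suc: "\<And>k. B (k + 1) = B k + b k"
    and tau_Suc: "\<And>k. \<tau> (k + 1) = \<tau> k + b k * \<mu>"
    and xt: "\<And>k. xt k = (B k / B (k + 1)) *\<^sub>R y k + (b k / B (k + 1)) *\<^sub>R x k"
    and yt_dom: "\<And>k. yt (k + 1) \<in> edom \<Phi>"
    and Gamma: "\<And>k. proper (\<Gamma> k)" "\<And>k. closed_function (\<Gamma> k)"
          "\<And>k. strongly_convex (\<mu> + 1 / lam) (\<Gamma> k)"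
    and Gamma_le: "\<And>k v. \<Gamma> k v \<le> \<Phi> v + ereal (1 / (2 * lam) * (norm (v - xt k))\<^sup>2)"
    and A_pos: "\<And>k. 0 < A k"
    and z: "\<And>k. is_arg_min (\<lambda>v. \<Gamma> k v + 1 / (2 * A k) * ereal ((norm (v - xt k))\<^sup>2))
                   (\<lambda>_. True) (z (k + 1))"
    and uh: "\<And>k. uh (k + 1) = real_of_ereal (1 / A k) *\<^sub>R (xt k - z (k + 1))"
    and inexact: "\<And>k. ereal ((norm (lam *\<^sub>R uh (k + 1)))\<^sup>2)
            + ereal (2 * lam) *
                (\<Phi> (yt (k + 1)) + ereal (1 / (2 * lam) * (norm (yt (k + 1) - xt k))\<^sup>2) - \<Gamma> k (z (k + 1)))
          \<le> ereal (\<sigma> * (norm (yt (k + 1) - xt k))\<^sup>2 + 2 * lam * \<delta> k)"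
    and y_Suc: "\<And>k. \<Phi> (y (k + 1)) \<le> \<Phi> (yt (k + 1))"
    and u: "\<And>k. u (k + 1) = uh (k + 1) + (1 / lam) *\<^sub>R (xt k - z (k + 1))"
    and x_Suc: "\<And>k. x (k + 1) =
          (1 / \<tau> (k + 1)) *\<^sub>R (\<tau> k *\<^sub>R x k + (b k * \<mu>) *\<^sub>R z (k + 1) - b k *\<^sub>R u (k + 1))"

end

theory Submission
  imports Defs
begin

text \<open>Since \<open>z\<close> minimizes the model plus a prox term, strong convexity of the model gives quadratic growth
  around \<open>z\<close>. Subtracting the quadratic \<open>\<parallel>v - xt\<parallel>\<^sup>2 / (2 lam)\<close> leaves a minorant
  \<open>G + u \<bullet> (v - z) + \<mu> / 2 \<parallel>v - z\<parallel>\<^sup>2\<close> of \<open>\<Phi>\<close>, and the inexactness criterion bounds \<open>\<Phi>\<close> at \<open>yt\<close> in terms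
  of it. The point \<open>x\<close> generated next minimizes \<open>b\<close> times this minorant plus the prox term centred at
  the current \<open>x\<close>, and \<open>b\<^sup>2 = lam \<tau> (B + b)\<close>, so that for each \<open>v\<close> the potential
  \<open>B (\<Phi> y - \<Phi> v) + \<tau> / 2 \<parallel>x - v\<parallel>\<^sup>2\<close> decreases up to the errors \<open>B \<delta>\<close>. Both rates follow by telescoping
  with \<open>v\<close> the minimizer nearest to the initial point. The errors are summable because
  \<open>sqrt B\<close> grows at most like the affine recursion with factor \<open>1 + sqrt (lam \<mu>)\<close>.\<close>

section \<open>Inner-product inequalities behind one iteration\<close>

lemma strongly_convex_prox_growth:
  fixes f :: "'a::real_inner \<Rightarrow> ereal"
  assumes sc: "strongly_convex m f"
    and min: "is_arg_min (\<lambda>w. f w + ereal (c / 2 * (norm (w - p))\<^sup>2)) (\<lambda>_. True) z"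
    and fz: "f z = ereal r" and fv: "f v = ereal s"
  shows "r + c * ((p - z) \<bullet> (v - z)) + m / 2 * (norm (v - z))\<^sup>2 \<le> s"
proof -
  define N where "N = (norm (v - z))\<^sup>2"
  define J where "J = (z - p) \<bullet> (v - z)"
  define P where "P = s - r - m / 2 * N + c * J"
  define Q where "Q = (m + c) / 2 * N"
  \<comment> \<open>Comparing \<open>z\<close> with the point a fraction \<open>t\<close> of the way
    to \<open>v\<close> and dividing by \<open>t\<close> leaves the first-order part
    \<open>P\<close> and a remainder linear in \<open>t\<close>.\<close>
  have ineq: "0 \<le> P + t * Q" if t: "0 < t" "t < 1" for t
  proof -
    define w where "w = t *\<^sub>R v + (1 - t) *\<^sub>R z"
    have "f w \<le> ereal t * f v + ereal (1 - t) * f z - ereal (m / 2 * t * (1 - t) * (norm (v - z))\<^sup>2)"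
      unfolding w_def
      by (rule sc[unfolded strongly_convex_def, rule_format]) (use t fz fv in \<open>simp_all add: edom_def\<close>)
    then have fw: "f w \<le> ereal (t * s + (1 - t) * r - m / 2 * t * (1 - t) * N)"
      by (simp add: fz fv N_def)
    have "f z + ereal (c / 2 * (norm (z - p))\<^sup>2) \<le> f w + ereal (c / 2 * (norm (w - p))\<^sup>2)"
      using min by (auto simp: is_arg_min_def not_less)
    also have "\<dots> \<le> ereal (t * s + (1 - t) * r - m / 2 * t * (1 - t) * N) + ereal (c / 2 * (norm (w - p))\<^sup>2)"
      by (intro add_mono fw order_refl)
    finally have "r + c / 2 * (norm (z - p))\<^sup>2
        \<le> t * s + (1 - t) * r - m / 2 * t * (1 - t) * N + c / 2 * (norm (w - p))\<^sup>2"
      by (simp add: fz)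
    moreover have "(norm (w - p))\<^sup>2 = (norm (z - p))\<^sup>2 + 2 * t * J + t\<^sup>2 * N"
    proof -
      have w: "w - p = (z - p) + t *\<^sub>R (v - z)" by (simp add: w_def algebra_simps)
      show ?thesis
        unfolding w N_def J_def power2_norm_eq_inner
        by (simp add: inner_add_left inner_add_right inner_commute power2_eq_square)
    qed
    ultimately have "0 \<le> t * (P + t * Q)"
      by (simp add: P_def Q_def field_simps power2_eq_square)
    then show ?thesis using t by (simp add: zero_le_mult_iff)
  qed
  \<comment> \<open>Letting \<open>t\<close> tend to 0 from the right removes \<open>Q\<close>, so
    the full modulus \<open>m\<close> survives and \<open>c * (p - z)\<close> acts as a subgradient
    of \<open>f\<close> at \<open>z\<close>.\<close>
  have "((\<lambda>t. P + t * Q) \<longlongrightarrow> P + 0 * Q) (at_right 0)"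
    by (intro tendsto_intros)
  moreover have "\<forall>\<^sub>F t in at_right (0::real). 0 \<le> P + t * Q"
    unfolding eventually_at_right_field using ineq by (intro exI[of _ 1]) auto
  ultimately have "0 \<le> P"
    using tendsto_lowerbound[of "\<lambda>t. P + t * Q" P "at_right 0" 0] by simp
  then show ?thesis
    by (simp add: P_def J_def N_def inner_diff_left algebra_simps)
qed

text \<open>Here \<open>q\<close> is the minorant without its constant. The equation for
  \<open>x'\<close> says that the gradient of
  \<open>b * q w + \<tau> / 2 * (norm (x - w))\<^sup>2\<close> in \<open>w\<close> vanishes at
  \<open>x'\<close>; the defining relation of \<open>b\<close> then makes a completed square match
  the term in \<open>norm u\<close>.\<close>

lemma accelerated_step:
  fixes x x' y z u v xt :: "'a::real_inner"
  assumes "0 \<le> B" "0 < b" "0 < \<tau>" "0 \<le> \<mu>"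
    and b: "b\<^sup>2 = lam * \<tau> * (B + b)"
    and xt: "(B + b) *\<^sub>R xt = B *\<^sub>R y + b *\<^sub>R x"
    and x': "(\<tau> + b * \<mu>) *\<^sub>R x' = \<tau> *\<^sub>R x + (b * \<mu>) *\<^sub>R z - b *\<^sub>R u"
  defines "q \<equiv> \<lambda>v. u \<bullet> (v - z) + \<mu> / 2 * (norm (v - z))\<^sup>2"
  shows "(B + b) * (u \<bullet> (xt - z) - lam / 2 * (norm u)\<^sup>2) + (\<tau> + b * \<mu>) / 2 * (norm (x' - v))\<^sup>2
    \<le> B * q y + b * q v + \<tau> / 2 * (norm (x - v))\<^sup>2"
proof -
  have cross: "(b *\<^sub>R u + (b * \<mu>) *\<^sub>R (x' - z) - \<tau> *\<^sub>R (x - x')) \<bullet> (v - x') = 0"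
  proof -
    have "b *\<^sub>R u + (b * \<mu>) *\<^sub>R (x' - z) - \<tau> *\<^sub>R (x - x') = 0"
      using x' by (simp add: algebra_simps)
    then show ?thesis by simp
  qed
  \<comment> \<open>A quadratic with curvature \<open>\<tau> + b * \<mu>\<close> equals its value at
    its stationary point plus half the curvature times the squared distance to that point.\<close>
  have split: "b * q v + \<tau> / 2 * (norm (x - v))\<^sup>2
      = b * q x' + \<tau> / 2 * (norm (x - x'))\<^sup>2 + (\<tau> + b * \<mu>) / 2 * (norm (x' - v))\<^sup>2"
  proof -
    define e where "e = v - x'"
    have v: "v = x' + e" by (simp add: e_def)
    have n1: "(norm (v - z))\<^sup>2 = (norm (x' - z))\<^sup>2 + 2 * ((x' - z) \<bullet> e) + (norm e)\<^sup>2"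
      unfolding v power2_norm_eq_inner by (simp add: algebra_simps inner_commute)
    have n2: "(norm (x - v))\<^sup>2 = (norm (x - x'))\<^sup>2 - 2 * ((x - x') \<bullet> e) + (norm e)\<^sup>2"
      unfolding v power2_norm_eq_inner by (simp add: algebra_simps inner_commute)
    have n3: "(norm (x' - v))\<^sup>2 = (norm e)\<^sup>2" by (simp add: v)
    have n4: "u \<bullet> (v - z) = u \<bullet> (x' - z) + u \<bullet> e" by (simp add: v algebra_simps)
    have "b * (u \<bullet> e) + b * \<mu> * ((x' - z) \<bullet> e) - \<tau> * ((x - x') \<bullet> e) = 0"
      using cross unfolding e_def[symmetric] by (simp only: inner_diff_left[of "_ + _"] inner_add_left inner_scaleR_left)
    then show ?thesis
      unfolding q_def n1 n2 n3 n4 by (simp add: field_simps)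
  qed
  \<comment> \<open>The \<mu>-terms of \<open>q\<close> are dropped, and the linear parts at
    \<open>y\<close> and \<open>x'\<close> combine through the definition of \<open>xt\<close> as a
    weighted average of \<open>y\<close> and \<open>x\<close>.\<close>
  have lin: "(B + b) * (u \<bullet> (xt - z)) + b * (u \<bullet> (x' - x)) \<le> B * q y + b * q x'"
  proof -
    have "(B + b) * (u \<bullet> xt) = B * (u \<bullet> y) + b * (u \<bullet> x)"
      using arg_cong[OF xt, of "\<lambda>w. u \<bullet> w"] by (simp add: inner_add_right)
    moreover have "0 \<le> B * (\<mu> * (norm (y - z))\<^sup>2)" "0 \<le> b * (\<mu> * (norm (x' - z))\<^sup>2)"
      using assms by auto
    ultimately show ?thesis
      unfolding q_def by (simp add: algebra_simps)
  qed
  have sq: "- ((B + b) * (lam / 2 * (norm u)\<^sup>2)) \<le> b * (u \<bullet> (x' - x)) + \<tau> / 2 * (norm (x - x'))\<^sup>2"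
  proof -
    define d where "d = x' - x"
    \<comment> \<open>By \<open>b\<close>, the coefficient \<open>b\<^sup>2\<close> of the squared
      norm of \<open>u\<close> is \<open>lam * \<tau> * (B + b)\<close>, so a factor
      \<open>2 * \<tau>\<close> can be taken out.\<close>
    have "0 \<le> (norm (\<tau> *\<^sub>R d + b *\<^sub>R u))\<^sup>2" by simp
    also have "\<dots> = \<tau>\<^sup>2 * (norm d)\<^sup>2 + 2 * \<tau> * b * (u \<bullet> d) + b\<^sup>2 * (norm u)\<^sup>2"
      unfolding power2_norm_eq_inner
      by (simp add: inner_add_left inner_add_right inner_commute power2_eq_square)
    also have "\<dots> = 2 * \<tau> * (\<tau> / 2 * (norm d)\<^sup>2 + b * (u \<bullet> d) + (B + b) * (lam / 2 * (norm u)\<^sup>2))"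
      unfolding b by (simp add: algebra_simps power2_eq_square)
    finally have "0 \<le> \<tau> / 2 * (norm d)\<^sup>2 + b * (u \<bullet> d) + (B + b) * (lam / 2 * (norm u)\<^sup>2)"
      using \<open>0 < \<tau>\<close> by (simp add: zero_le_mult_iff)
    then show ?thesis by (simp add: d_def norm_minus_commute)
  qed
  from split lin sq show ?thesis by (simp add: algebra_simps)
qed

section \<open>Summability and semicontinuity\<close>

lemma summable_square_geometric:
  fixes q :: real
  assumes "0 \<le> q" "q < 1"
  shows "summable (\<lambda>n. (real (n + 1))\<^sup>2 * q ^ n)"
proof -
  have 1: "summable (\<lambda>n. diffs (\<lambda>_. 1) n * x ^ n)" if "norm x < 1" for x :: real
    by (rule termdiff_converges[OF that]) (simp add: summable_geometric)
  \<comment> \<open>Differentiating the geometric series twice gives the coefficients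
    \<open>(n + 1) * (n + 2)\<close>, which dominate \<open>(n + 1)\<^sup>2\<close>.\<close>
  have 2: "summable (\<lambda>n. diffs (diffs (\<lambda>_. 1)) n * q ^ n)"
    by (rule termdiff_converges[of _ 1]) (use assms 1 in auto)
  show ?thesis
  proof (rule summable_comparison_test'[OF 2, of 0])
    fix n
    have "(real (n + 1))\<^sup>2 \<le> diffs (diffs (\<lambda>_. 1)) n"
      by (simp add: diffs_def power2_eq_square algebra_simps)
    then show "norm ((real (n + 1))\<^sup>2 * q ^ n) \<le> diffs (diffs (\<lambda>_. 1)) n * q ^ n"
      using assms by (simp add: mult_right_mono)
  qed
qed

text \<open>Applied at the infimum, this makes the set of minimizers closed, so that the distance to
  it is attained. The filter \<open>at x\<close> is punctured, which fits limit points: values at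
  most \<open>c\<close> occur frequently near \<open>x\<close>, so the lower limit cannot exceed
  \<open>c\<close>.\<close>

lemma lower_semicontinuous_closed_sublevel:
  assumes "lower_semicontinuous f"
  shows "closed {x. f x \<le> c}"
  unfolding closed_limpt
proof (intro allI impI)
  fix x assume lp: "x islimpt {x. f x \<le> c}"
  have "Liminf (at x) f \<le> c"
  proof (rule ccontr)
    assume "\<not> Liminf (at x) f \<le> c"
    then have "\<forall>\<^sub>F w in at x. c < f w"
      by (metis less_LiminfD not_le)
    moreover have "\<exists>\<^sub>F w in at x. f w \<le> c"
      using lp by (simp add: islimpt_conv_frequently_at)
    ultimately show False
      by (auto simp: frequently_def not_le)
  qed
  then show "x \<in> {x. f x \<le> c}"
    using assms order_trans unfolding lower_semicontinuous_def by blast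
qed

lemma minimizers_eq_sublevel: "minimizers f = {v. f v \<le> (INF w. f w)}"
  for f :: "'a \<Rightarrow> ereal"
  by (auto simp: minimizers_def is_arg_min_def not_less le_INF_iff)

section \<open>Identities and growth of the scalar sequences\<close>

context FLOrA
begin

lemma tau_pos: "0 < \<tau> k" and B_nonneg: "0 \<le> B k" and b_pos: "0 < b k"
proof -
  have b: "0 < b k" if "0 < \<tau> k" "0 \<le> B k" for k
    unfolding b using that lambda
    by (intro divide_pos_pos add_pos_nonneg mult_pos_pos real_sqrt_ge_zero add_nonneg_nonneg) auto
  have *: "0 < \<tau> k \<and> 0 \<le> B k"
  proof (induction k)
    case 0 show ?case by (simp add: tau_0 B_0)
  next
    case (Suc k)
    then show ?case
      using b[of k] B_Suc[of k] tau_Suc[of k] mu by (simp add: add_pos_nonneg)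
  qed
  then show "0 < \<tau> k" "0 \<le> B k" by auto
  show "0 < b k" using b * by blast
qed

lemma B_Suc_pos: "0 < B (k + 1)"
  using B_Suc[of k] b_pos[of k] B_nonneg[of k] by simp

text \<open>The formula for \<open>b k\<close> is the larger root of the quadratic equation t^2 =
  \<open>lam * \<tau> k * (B k + t)\<close>.\<close>

lemma b_square: "(b k)\<^sup>2 = lam * \<tau> k * (B k + b k)"
proof -
  define D where "D = lam\<^sup>2 * (\<tau> k)\<^sup>2 + 4 * lam * \<tau> k * B k"
  have "0 \<le> D" unfolding D_def using lambda tau_pos[of k] B_nonneg[of k] by simp
  moreover have "2 * b k - lam * \<tau> k = sqrt D"
    unfolding D_def using b[of k] by simp
  ultimately have "(2 * b k - lam * \<tau> k)\<^sup>2 = D" by simp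
  then show ?thesis by (simp add: D_def algebra_simps power2_eq_square)
qed

lemma tau_eq: "\<tau> k = 1 + \<mu> * B k"
proof (induction k)
  case 0 show ?case by (simp add: tau_0 B_0)
next
  case (Suc k)
  then show ?case using B_Suc[of k] tau_Suc[of k] by (simp add: algebra_simps)
qed

text \<open>With s = \<open>sqrt (lam * \<mu>)\<close>, subadditivity of the square root gives
  \<open>sqrt (B (k + 1)) \<le> (1 + s) * sqrt (B k) + sqrt lam\<close>. The factor
  \<open>real k\<close> absorbs the additive term.\<close>

lemma sqrt_B_le: "sqrt (B k) \<le> sqrt lam * real k * (1 + sqrt (lam * \<mu>)) ^ k"
proof (induction k)
  case 0 show ?case by (simp add: B_0)
next
  case (Suc k)
  define s where "s = sqrt (lam * \<mu>)"
  have s: "0 \<le> s" using lambda mu by (simp add: s_def)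
  have tau: "0 < \<tau> k" and B: "0 \<le> B k" using tau_pos B_nonneg by auto
  have "sqrt (lam\<^sup>2 * (\<tau> k)\<^sup>2 + 4 * lam * \<tau> k * B k) \<le> sqrt ((lam * \<tau> k)\<^sup>2) + sqrt (4 * (lam * \<tau> k * B k))"
    using sqrt_add_le_add_sqrt[of "(lam * \<tau> k)\<^sup>2" "4 * (lam * \<tau> k * B k)"] tau B lambda
    by (simp add: power_mult_distrib mult.assoc)
  also have "\<dots> = lam * \<tau> k + 2 * sqrt (lam * \<tau> k * B k)"
    using lambda tau by (simp add: real_sqrt_mult)
  finally have "b k \<le> lam * \<tau> k + sqrt (lam * \<tau> k * B k)"
    using b[of k] by simp
  also have "sqrt (lam * \<tau> k * B k) \<le> sqrt lam * sqrt (B k) + s * B k"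
  proof -
    have "lam * \<tau> k * B k = lam * B k + lam * \<mu> * (B k)\<^sup>2"
      by (simp add: tau_eq algebra_simps power2_eq_square)
    then show ?thesis
      using sqrt_add_le_add_sqrt[of "lam * B k" "lam * \<mu> * (B k)\<^sup>2"] B lambda mu
      by (simp add: s_def real_sqrt_mult)
  qed
  finally have b_le: "b k \<le> lam * \<tau> k + (sqrt lam * sqrt (B k) + s * B k)" by simp
  have s2: "s\<^sup>2 = lam * \<mu>" using lambda mu by (simp add: s_def)
  have "B (Suc k) \<le> (1 + s + s\<^sup>2) * B k + sqrt lam * sqrt (B k) + lam"
    using b_le B_Suc[of k] unfolding s2 by (simp add: tau_eq algebra_simps)
  \<comment> \<open>The square exceeds the left side by \<open>s * B k\<close> and nonnegative
    multiples of \<open>sqrt lam * sqrt (B k)\<close>.\<close>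
  also have "\<dots> \<le> ((1 + s) * sqrt (B k) + sqrt lam)\<^sup>2"
  proof -
    have "((1 + s) * sqrt (B k) + sqrt lam)\<^sup>2
        = (1 + s)\<^sup>2 * B k + 2 * (1 + s) * (sqrt lam * sqrt (B k)) + lam"
      using B lambda by (simp add: power2_sum power_mult_distrib)
    moreover have "0 \<le> s * B k" "0 \<le> sqrt lam * sqrt (B k)" "0 \<le> s * (sqrt lam * sqrt (B k))"
      using s B lambda by auto
    ultimately show ?thesis by (simp add: power2_eq_square algebra_simps)
  qed
  finally have "sqrt (B (Suc k)) \<le> (1 + s) * sqrt (B k) + sqrt lam"
    using s B lambda by (intro real_le_lsqrt) auto
  also have "\<dots> \<le> (1 + s) * (sqrt lam * real k * (1 + s) ^ k) + sqrt lam * (1 + s) ^ Suc k"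
  proof (rule add_mono)
    show "(1 + s) * sqrt (B k) \<le> (1 + s) * (sqrt lam * real k * (1 + s) ^ k)"
      using Suc s unfolding s_def by (intro mult_left_mono) auto
    show "sqrt lam \<le> sqrt lam * (1 + s) ^ Suc k"
      using s lambda one_le_power[of "1 + s" "Suc k"] by (simp del: power_Suc)
  qed
  also have "\<dots> = sqrt lam * real (Suc k) * (1 + s) ^ Suc k"
    by (simp add: algebra_simps)
  finally show ?case by (simp add: s_def)
qed

text \<open>Squaring the growth bound gives a majorant of the form n^2 times a geometric term of
  ratio \<open>r * \<alpha>\<close>; the bound imposed on \<alpha> says exactly that this ratio is
  below 1.\<close>

lemma summable_B_alpha: "summable (\<lambda>i. B (i + 1) * \<alpha> ^ i)"
proof -
  define r where "r = (1 + sqrt (lam * \<mu>))\<^sup>2"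
  have "0 \<le> sqrt (lam * \<mu>)" using lambda mu by simp
  then have r: "0 < r" unfolding r_def by (intro zero_less_power add_pos_nonneg) auto
  have q: "0 \<le> r * \<alpha>" "r * \<alpha> < 1"
    using alpha(1) alpha(2)[folded r_def] r by (auto simp: field_simps)
  have "summable (\<lambda>n. lam * r * ((real (n + 1))\<^sup>2 * (r * \<alpha>) ^ n))"
    by (intro summable_mult summable_square_geometric q)
  then show ?thesis
  proof (rule summable_comparison_test'[of _ 0])
    fix n
    have "B (n + 1) = (sqrt (B (n + 1)))\<^sup>2" using B_nonneg by simp
    also have "\<dots> \<le> (sqrt lam * real (n + 1) * (1 + sqrt (lam * \<mu>)) ^ (n + 1))\<^sup>2"
      by (intro power_mono sqrt_B_le) (simp add: B_nonneg)
    also have "\<dots> = lam * (real (n + 1))\<^sup>2 * r ^ (n + 1)"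
      using lambda by (simp only: power_mult_distrib r_def power_mult[symmetric] mult.commute[of 2]) simp
    finally have "B (n + 1) * \<alpha> ^ n \<le> lam * (real (n + 1))\<^sup>2 * r ^ (n + 1) * \<alpha> ^ n"
      using alpha by (intro mult_right_mono) auto
    then show "norm (B (n + 1) * \<alpha> ^ n) \<le> lam * r * ((real (n + 1))\<^sup>2 * (r * \<alpha>) ^ n)"
      using alpha B_nonneg[of "n + 1"] by (simp add: power_mult_distrib mult_ac)
  qed
qed

end

section \<open>The quadratic minorant and the potential\<close>

locale FLOrA_proper = FLOrA +
  assumes proper: "proper \<Phi>"
begin

text \<open>Real-valued version of \<Phi> for arithmetic. It is faithful only on
  \<open>edom \<Phi>\<close>, since infinite values are sent to 0.\<close>

definition \<phi> where
  "\<phi> v = real_of_ereal (\<Phi> v)"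

lemma ereal_phi: "v \<in> edom \<Phi> \<Longrightarrow> \<Phi> v = ereal (\<phi> v)"
  using proper unfolding \<phi>_def edom_def proper_def by (cases "\<Phi> v") auto

lemma y_dom: "y k \<in> edom \<Phi>"
proof (cases k)
  case 0 then show ?thesis using x_0 y_0 by simp
next
  case (Suc j)
  then show ?thesis using y_Suc[of j] yt_dom[of j] by (auto simp: edom_def)
qed

lemma phi_y_le: "\<phi> (y (k + 1)) \<le> \<phi> (yt (k + 1))"
  using y_Suc[of k] ereal_phi[OF y_dom[of "k + 1"]] ereal_phi[OF yt_dom[of k]] by simp

text \<open>One constant \<open>G\<close> must serve both claims. In the second, \<open>G\<close>
  plus the bracket is the least value of the linear part of the minorant plus the prox term of
  parameter \<open>lam\<close> centred at \<open>xt k\<close>.\<close>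

lemma quadratic_minorant:
  obtains G where
    "\<And>v. v \<in> edom \<Phi> \<Longrightarrow> G + (u (k + 1) \<bullet> (v - z (k + 1)) + \<mu> / 2 * (norm (v - z (k + 1)))\<^sup>2) \<le> \<phi> v"
    "\<phi> (yt (k + 1)) + (1 - \<sigma>) / (2 * lam) * (norm (yt (k + 1) - xt k))\<^sup>2
      \<le> G + (u (k + 1) \<bullet> (xt k - z (k + 1)) - lam / 2 * (norm (u (k + 1)))\<^sup>2) + \<delta> k"
proof -
  define w where "w = xt k - z (k + 1)"
  define Y where "Y = (norm (yt (k + 1) - xt k))\<^sup>2"
  \<comment> \<open>The real number \<open>a\<close> stands for 1/A and is 0 when A is infinite, so
    both cases are treated alike from here on.\<close>
  obtain a where a: "1 / A k = ereal a" "1 / (2 * A k) = ereal (a / 2)"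
  proof (cases "A k")
    case (real r)
    then show ?thesis using A_pos[of k] by (intro that[of "1 / r"]) (simp_all add: one_ereal_def)
  next
    case PInf
    then show ?thesis by (intro that[of 0]) (simp_all add: zero_ereal_def)
  next
    case MInf
    then show ?thesis using A_pos[of k] by simp
  qed
  have min: "is_arg_min (\<lambda>v. \<Gamma> k v + ereal (a / 2 * (norm (v - xt k))\<^sup>2)) (\<lambda>_. True) (z (k + 1))"
    using z[of k] unfolding a(2) by simp
  have Gam_fin: "\<exists>r. \<Gamma> k v = ereal r" if "\<Gamma> k v < \<infinity>" for v
    using Gamma(1)[of k] that unfolding proper_def by (cases "\<Gamma> k v") auto
  obtain g where g: "\<Gamma> k (z (k + 1)) = ereal g"
  proof -
    obtain v where "\<Gamma> k v < \<infinity>" using Gamma(1)[of k] unfolding proper_def edom_def by auto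
    moreover have "\<Gamma> k (z (k + 1)) + ereal (a / 2 * (norm (z (k + 1) - xt k))\<^sup>2)
        \<le> \<Gamma> k v + ereal (a / 2 * (norm (v - xt k))\<^sup>2)"
      using min by (auto simp: is_arg_min_def not_less)
    ultimately have "\<Gamma> k (z (k + 1)) < \<infinity>" by auto
    then show ?thesis using Gam_fin that by blast
  qed
  have uh': "uh (k + 1) = a *\<^sub>R w" using uh[of k] by (simp add: a(1) w_def)
  have u': "u (k + 1) = (a + 1 / lam) *\<^sub>R w"
    unfolding u uh' w_def[symmetric] by (rule scaleR_left_distrib[symmetric])
  \<comment> \<open>This is the model minus the quadratic centred at \<open>xt k\<close>, evaluated
    at \<open>z (k + 1)\<close>. Subtracting that quadratic turns the slope
    \<open>a *\<^sub>R w\<close> into \<open>u (k + 1)\<close> and the modulus \<mu> + 1/lam into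
    \<mu>.\<close>
  define G where "G = g - 1 / (2 * lam) * (norm w)\<^sup>2"
  show ?thesis
  proof (rule that[of G])
    fix v assume v: "v \<in> edom \<Phi>"
    define e where "e = v - z (k + 1)"
    have le: "\<Gamma> k v \<le> ereal (\<phi> v + 1 / (2 * lam) * (norm (v - xt k))\<^sup>2)"
      using Gamma_le[of k v] ereal_phi[OF v] by simp
    then have "\<Gamma> k v < \<infinity>" by auto
    then obtain s where s: "\<Gamma> k v = ereal s" using Gam_fin by blast
    have "g + a * (w \<bullet> e) + (\<mu> + 1 / lam) / 2 * (norm e)\<^sup>2 \<le> s"
      using strongly_convex_prox_growth[OF Gamma(3) min g s] by (simp add: w_def e_def)
    also have "s \<le> \<phi> v + 1 / (2 * lam) * (norm (v - xt k))\<^sup>2" using le s by simp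
    also have "(norm (v - xt k))\<^sup>2 = (norm e)\<^sup>2 - 2 * (w \<bullet> e) + (norm w)\<^sup>2"
      unfolding w_def e_def power2_norm_eq_inner by (simp add: algebra_simps inner_commute)
    finally show "G + (u (k + 1) \<bullet> (v - z (k + 1)) + \<mu> / 2 * (norm (v - z (k + 1)))\<^sup>2) \<le> \<phi> v"
      unfolding u' e_def[symmetric] G_def using lambda by (simp add: field_simps)
  next
    have "(norm (lam *\<^sub>R uh (k + 1)))\<^sup>2 + 2 * lam * (\<phi> (yt (k + 1)) + 1 / (2 * lam) * Y - g)
        \<le> \<sigma> * Y + 2 * lam * \<delta> k"
      using inexact[of k] unfolding ereal_phi[OF yt_dom] g Y_def by simp
    then have "lam\<^sup>2 * a\<^sup>2 * (norm w)\<^sup>2 + 2 * lam * (\<phi> (yt (k + 1)) - g) + Y \<le> \<sigma> * Y + 2 * lam * \<delta> k"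
      unfolding uh' using lambda by (simp add: power_mult_distrib algebra_simps)
    then have "\<phi> (yt (k + 1)) + (1 - \<sigma>) / (2 * lam) * Y \<le> g - lam / 2 * a\<^sup>2 * (norm w)\<^sup>2 + \<delta> k"
      using lambda by (simp add: field_simps power2_eq_square)
    also have "g - lam / 2 * a\<^sup>2 * (norm w)\<^sup>2
        = G + (u (k + 1) \<bullet> w - lam / 2 * (norm (u (k + 1)))\<^sup>2)"
    proof -
      have "u (k + 1) \<bullet> w = (a + 1 / lam) * (norm w)\<^sup>2"
        unfolding u' by (simp add: power2_norm_eq_inner)
      moreover have "(norm (u (k + 1)))\<^sup>2 = (a + 1 / lam)\<^sup>2 * (norm w)\<^sup>2"
        unfolding u' by (simp add: power_mult_distrib)
      ultimately show ?thesis
        using lambda by (simp add: G_def field_simps power2_eq_square)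
    qed
    finally show "\<phi> (yt (k + 1)) + (1 - \<sigma>) / (2 * lam) * (norm (yt (k + 1) - xt k))\<^sup>2
      \<le> G + (u (k + 1) \<bullet> (xt k - z (k + 1)) - lam / 2 * (norm (u (k + 1)))\<^sup>2) + \<delta> k"
      by (simp add: Y_def w_def)
  qed
qed

lemma potential_decrease:
  assumes v: "v \<in> edom \<Phi>"
  shows "B (k + 1) * (\<phi> (y (k + 1)) - \<phi> v) + \<tau> (k + 1) / 2 * (norm (x (k + 1) - v))\<^sup>2
      + (1 - \<sigma>) / (2 * lam) * (B (k + 1) * (norm (yt (k + 1) - xt k))\<^sup>2)
    \<le> B k * (\<phi> (y k) - \<phi> v) + \<tau> k / 2 * (norm (x k - v))\<^sup>2 + B (k + 1) * \<delta> k"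
proof -
  define q where "q w = u (k + 1) \<bullet> (w - z (k + 1)) + \<mu> / 2 * (norm (w - z (k + 1)))\<^sup>2" for w
  define Y where "Y = (norm (yt (k + 1) - xt k))\<^sup>2"
  define S where "S = u (k + 1) \<bullet> (xt k - z (k + 1)) - lam / 2 * (norm (u (k + 1)))\<^sup>2"
  obtain G where G1: "\<And>w. w \<in> edom \<Phi> \<Longrightarrow> G + q w \<le> \<phi> w"
    and G2: "\<phi> (yt (k + 1)) + (1 - \<sigma>) / (2 * lam) * Y \<le> G + S + \<delta> k"
    by (rule quadratic_minorant[of k, folded q_def Y_def S_def]) (rule that)
  have B': "B (k + 1) = B k + b k" and T': "\<tau> (k + 1) = \<tau> k + b k * \<mu>"
    using B_Suc tau_Suc by auto
  have step: "(B k + b k) * S + (\<tau> k + b k * \<mu>) / 2 * (norm (x (k + 1) - v))\<^sup>2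
      \<le> B k * q (y k) + b k * q v + \<tau> k / 2 * (norm (x k - v))\<^sup>2"
    unfolding S_def q_def
  proof (rule accelerated_step)
    show "(B k + b k) *\<^sub>R xt k = B k *\<^sub>R y k + b k *\<^sub>R x k"
      unfolding B'[symmetric] xt using B_Suc_pos[of k] by (simp add: scaleR_add_right)
    show "(\<tau> k + b k * \<mu>) *\<^sub>R x (k + 1)
        = \<tau> k *\<^sub>R x k + (b k * \<mu>) *\<^sub>R z (k + 1) - b k *\<^sub>R u (k + 1)"
      using tau_pos[of "k + 1"] unfolding x_Suc T' by simp
  qed (use B_nonneg b_pos tau_pos mu b_square in auto)
  \<comment> \<open>The weights \<open>B k\<close> and \<open>b k\<close> add up to
    \<open>B (k + 1)\<close>, so the unknown \<open>G\<close> cancels against the upper bound at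
    \<open>yt (k + 1)\<close>.\<close>
  have "B k * (G + q (y k)) \<le> B k * \<phi> (y k)" "b k * (G + q v) \<le> b k * \<phi> v"
    using G1[OF y_dom] G1[OF v] B_nonneg[of k] b_pos[of k] by (auto intro: mult_left_mono)
  moreover have "(B k + b k) * (\<phi> (y (k + 1)) + (1 - \<sigma>) / (2 * lam) * Y) \<le> (B k + b k) * (G + S + \<delta> k)"
    using G2 phi_y_le[of k] B_nonneg[of k] b_pos[of k] by (intro mult_left_mono) auto
  ultimately show ?thesis
    using step unfolding B' T' Y_def[symmetric] by (simp add: algebra_simps)
qed

text \<open>Telescoping; \<open>B 0 = 0\<close> and \<open>\<tau> 0 = 1\<close> reduce the initial
  potential to half the squared distance.\<close>

lemma potential_sum:
  assumes v: "v \<in> edom \<Phi>"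
  shows "B k * (\<phi> (y k) - \<phi> v) + \<tau> k / 2 * (norm (x k - v))\<^sup>2
      + (1 - \<sigma>) / (2 * lam) * (\<Sum>i<k. B (i + 1) * (norm (yt (i + 1) - xt i))\<^sup>2)
    \<le> (norm (x 0 - v))\<^sup>2 / 2 + \<delta>0 * (\<Sum>i<k. B (i + 1) * \<alpha> ^ i)"
proof (induction k)
  case 0 show ?case by (simp add: B_0 tau_0)
next
  case (Suc k)
  then show ?case
    using potential_decrease[OF v, of k] by (simp add: delta algebra_simps)
qed

lemma potential_bound:
  assumes v: "v \<in> edom \<Phi>" and C: "C = (\<Sum>i. B (i + 1) * \<alpha> ^ i)"
  shows "B k * (\<phi> (y k) - \<phi> v)
      + (1 - \<sigma>) / (2 * lam) * (\<Sum>i<k. B (i + 1) * (norm (yt (i + 1) - xt i))\<^sup>2)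
    \<le> (norm (x 0 - v))\<^sup>2 / 2 + \<delta>0 * C"
proof -
  have "(\<Sum>i<k. B (i + 1) * \<alpha> ^ i) \<le> C"
    unfolding C using alpha B_nonneg by (intro sum_le_suminf summable_B_alpha) auto
  then have "\<delta>0 * (\<Sum>i<k. B (i + 1) * \<alpha> ^ i) \<le> \<delta>0 * C"
    using delta0 by (rule mult_left_mono)
  moreover have "0 \<le> \<tau> k / 2 * (norm (x k - v))\<^sup>2" using tau_pos[of k] by simp
  ultimately show ?thesis using potential_sum[OF v, of k] by linarith
qed

text \<open>At a minimizer the function gap is nonnegative and can be discarded. Bounding a sum of
  two squares by the square of the sum produces the numerator of both step rates.\<close>

lemma weighted_step_sum_bound:
  assumes v: "v \<in> edom \<Phi>" "\<And>w. \<Phi> v \<le> \<Phi> w" and C: "C = (\<Sum>i. B (i + 1) * \<alpha> ^ i)"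
  shows "(1 - \<sigma>) * (\<Sum>i<k. B (i + 1) * (norm (yt (i + 1) - xt i))\<^sup>2)
    \<le> (sqrt lam * norm (x 0 - v) + sqrt (2 * lam * \<delta>0 * C))\<^sup>2"
proof -
  define S where "S = (\<Sum>i<k. B (i + 1) * (norm (yt (i + 1) - xt i))\<^sup>2)"
  have "0 \<le> C" unfolding C using alpha B_nonneg by (intro suminf_nonneg summable_B_alpha) auto
  have "\<phi> v \<le> \<phi> (y k)"
    using v(2)[of "y k"] unfolding ereal_phi[OF v(1)] ereal_phi[OF y_dom] by simp
  then have "0 \<le> B k * (\<phi> (y k) - \<phi> v)" using B_nonneg by simp
  then have "(1 - \<sigma>) / (2 * lam) * S \<le> (norm (x 0 - v))\<^sup>2 / 2 + \<delta>0 * C"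
    using potential_bound[OF v(1) C, of k] unfolding S_def by linarith
  then have "(1 - \<sigma>) * S \<le> lam * (norm (x 0 - v))\<^sup>2 + 2 * lam * \<delta>0 * C"
    using lambda by (simp add: field_simps)
  also have "\<dots> = (sqrt lam * norm (x 0 - v))\<^sup>2 + (sqrt (2 * lam * \<delta>0 * C))\<^sup>2"
    using lambda delta0 \<open>0 \<le> C\<close> by (simp add: power_mult_distrib)
  also have "\<dots> \<le> (sqrt lam * norm (x 0 - v) + sqrt (2 * lam * \<delta>0 * C))\<^sup>2"
    unfolding power2_sum using lambda delta0 \<open>0 \<le> C\<close> by (intro le_add_same_cancel1[THEN iffD2]) auto
  finally show ?thesis unfolding S_def .
qed

end

section \<open>Nearest minimizer and the final rates\<close>

theorem theorem4p5:
  fixes \<Phi> :: "real ^ 'n \<Rightarrow> ereal"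
    and \<mu> \<sigma> lam \<delta>0 \<alpha> :: real
    and \<delta> b B \<tau> :: "nat \<Rightarrow> real"
    and x y xt yt z uh u :: "nat \<Rightarrow> real ^ 'n"
    and \<Gamma> :: "nat \<Rightarrow> real ^ 'n \<Rightarrow> ereal"
    and A :: "nat \<Rightarrow> ereal"
    and \<Phi>_min :: ereal and R0 C :: real
  assumes "proper \<Phi>" and "lower_semicontinuous \<Phi>" and "strongly_convex \<mu> \<Phi>"
    and "minimizers \<Phi> \<noteq> {}"
    and "FLOrA \<Phi> \<mu> \<sigma> lam \<delta>0 \<alpha> \<delta> b B \<tau> x y xt yt z uh u \<Gamma> A"
    and "\<Phi>_min = (INF v. \<Phi> v)"
    and "R0 = (INF v\<in>minimizers \<Phi>. norm (x 0 - v))"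
    and "C = (\<Sum>i. B (i + 1) * \<alpha> ^ i)"
  shows "(\<exists>v\<in>minimizers \<Phi>. norm (x 0 - v) = R0)
       \<and> summable (\<lambda>i. B (i + 1) * \<alpha> ^ i)
       \<and> (\<forall>k. \<Phi> (y (k + 1)) - \<Phi>_min \<le> ereal (R0\<^sup>2 / (2 * B (k + 1)) + \<delta>0 * C / B (k + 1)))
       \<and> (\<sigma> < 1 \<longrightarrow>
            (\<forall>k. norm (yt (k + 1) - xt k)
               \<le> (sqrt lam * R0 + sqrt (2 * lam * \<delta>0 * C)) / sqrt ((1 - \<sigma>) * B (k + 1))) \<and>
            (\<forall>k. (MIN i\<in>{0..k}. norm (yt (i + 1) - xt i))
               \<le> (sqrt lam * R0 + sqrt (2 * lam * \<delta>0 * C)) / sqrt ((1 - \<sigma>) * (\<Sum>i=1..k+1. B i))))"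
proof -
  interpret FLOrA_proper \<Phi> \<mu> \<sigma> lam \<delta>0 \<alpha> \<delta> b B \<tau> x y xt yt z uh u \<Gamma> A
    using assms(1,5) by (simp add: FLOrA_proper_def FLOrA_proper_axioms_def)
  have "closed (minimizers \<Phi>)"
    unfolding minimizers_eq_sublevel by (rule lower_semicontinuous_closed_sublevel[OF assms(2)])
  \<comment> \<open>Closed nonempty sets in finite dimension contain a nearest point, so the infimum
    \<open>R0\<close> is a minimum and \<open>v\<close> serves as the comparison point in all
    bounds.\<close>
  then obtain v where v: "v \<in> minimizers \<Phi>"
    and nearest: "\<And>w. w \<in> minimizers \<Phi> \<Longrightarrow> dist (x 0) v \<le> dist (x 0) w"
    using distance_attains_inf assms(4) by blast
  have R0: "R0 = norm (x 0 - v)"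
    unfolding assms(7) using v nearest by (intro cInf_eq_minimum) (auto simp: dist_norm)
  have v_min: "\<Phi> v \<le> \<Phi> w" for w
    using v by (simp add: minimizers_def is_arg_min_def not_less)
  have v_dom: "v \<in> edom \<Phi>"
    using v_min[of "x 0"] x_0 by (auto simp: edom_def)
  have \<Phi>_min: "\<Phi>_min = ereal (\<phi> v)"
    unfolding assms(6) ereal_phi[OF v_dom, symmetric] using v_min by (intro INF_eqI) auto
  define R where "R = sqrt lam * R0 + sqrt (2 * lam * \<delta>0 * C)"
  define d where "d i = norm (yt (i + 1) - xt i)" for i
  have "0 \<le> C" unfolding assms(8) using alpha B_nonneg by (intro suminf_nonneg summable_B_alpha) auto
  then have R_nonneg: "0 \<le> R" unfolding R_def R0 using lambda delta0 by simp
  have gap: "\<Phi> (y (k + 1)) - \<Phi>_min \<le> ereal (R0\<^sup>2 / (2 * B (k + 1)) + \<delta>0 * C / B (k + 1))" for k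
  proof -
    have "0 \<le> (1 - \<sigma>) / (2 * lam) * (\<Sum>i<k + 1. B (i + 1) * (norm (yt (i + 1) - xt i))\<^sup>2)"
      using sigma lambda B_nonneg by (intro mult_nonneg_nonneg sum_nonneg divide_nonneg_pos) auto
    then have "B (k + 1) * (\<phi> (y (k + 1)) - \<phi> v) \<le> R0\<^sup>2 / 2 + \<delta>0 * C"
      using potential_bound[OF v_dom assms(8), of "k + 1"] unfolding R0 by linarith
    then have "\<phi> (y (k + 1)) - \<phi> v \<le> R0\<^sup>2 / (2 * B (k + 1)) + \<delta>0 * C / B (k + 1)"
      using B_Suc_pos[of k] by (simp add: field_simps)
    then show ?thesis unfolding \<Phi>_min ereal_phi[OF y_dom] by simp
  qed
  have steps: "(1 - \<sigma>) * (\<Sum>i<k. B (i + 1) * (d i)\<^sup>2) \<le> R\<^sup>2" for k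
    using weighted_step_sum_bound[OF v_dom v_min assms(8), of k] unfolding R_def R0 d_def .
  have le_quotient: "t \<le> R / sqrt c" if "c * t\<^sup>2 \<le> R\<^sup>2" "0 < c" for t c
  proof -
    have "(sqrt c * t)\<^sup>2 \<le> R\<^sup>2" using that by (simp add: power_mult_distrib)
    then have "sqrt c * t \<le> R" using R_nonneg by (rule power2_le_imp_le)
    then show ?thesis using that by (simp add: field_simps)
  qed
  have step: "d k \<le> R / sqrt ((1 - \<sigma>) * B (k + 1))" if "\<sigma> < 1" for k
  proof (rule le_quotient)
    have "0 \<le> (\<Sum>i<k. B (i + 1) * (d i)\<^sup>2)" using B_nonneg by (intro sum_nonneg) auto
    \<comment> \<open>Only the last summand is kept.\<close>
    then have "B (k + 1) * (d k)\<^sup>2 \<le> (\<Sum>i<k + 1. B (i + 1) * (d i)\<^sup>2)" by simp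
    then have "(1 - \<sigma>) * (B (k + 1) * (d k)\<^sup>2) \<le> (1 - \<sigma>) * (\<Sum>i<k + 1. B (i + 1) * (d i)\<^sup>2)"
      using that by (intro mult_left_mono) auto
    then show "(1 - \<sigma>) * B (k + 1) * (d k)\<^sup>2 \<le> R\<^sup>2"
      using steps[of "k + 1"] by (simp only: mult.assoc)
    show "0 < (1 - \<sigma>) * B (k + 1)" using that B_Suc_pos by simp
  qed
  have min_step: "(MIN i\<in>{0..k}. d i) \<le> R / sqrt ((1 - \<sigma>) * (\<Sum>i=1..k+1. B i))" if "\<sigma> < 1" for k
  proof (rule le_quotient)
    define m where "m = (MIN i\<in>{0..k}. d i)"
    \<comment> \<open>The minimum is attained, hence nonnegative, so \<open>m \<le> d i\<close> may
      be squared.\<close>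
    have "m \<in> d ` {0..k}" unfolding m_def by (intro Min_in) auto
    then have m: "0 \<le> m" by (auto simp: d_def)
    have idx: "(\<Sum>i=1..k+1. B i) = (\<Sum>i<k+1. B (i + 1))"
      by (rule sum.reindex_bij_witness[of _ "\<lambda>i. i + 1" "\<lambda>i. i - 1"]) auto
    have "(\<Sum>i=1..k+1. B i) * m\<^sup>2 = (\<Sum>i<k+1. B (i + 1) * m\<^sup>2)"
      unfolding idx by (rule sum_distrib_right)
    also have "\<dots> \<le> (\<Sum>i<k+1. B (i + 1) * (d i)\<^sup>2)"
    proof (intro sum_mono mult_left_mono power_mono m B_nonneg)
      fix i assume "i \<in> {..<k+1}"
      then show "m \<le> d i" unfolding m_def by (intro Min_le) auto
    qed
    finally have "(1 - \<sigma>) * ((\<Sum>i=1..k+1. B i) * m\<^sup>2) \<le> (1 - \<sigma>) * (\<Sum>i<k+1. B (i + 1) * (d i)\<^sup>2)"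
      using that by (intro mult_left_mono) auto
    also have "\<dots> \<le> R\<^sup>2" by (rule steps)
    finally show "(1 - \<sigma>) * (\<Sum>i=1..k+1. B i) * m\<^sup>2 \<le> R\<^sup>2" by (simp only: mult.assoc)
    have "0 < (\<Sum>i=1..k+1. B i)"
      unfolding idx by (intro sum_pos) (auto simp: B_Suc_pos[simplified])
    then show "0 < (1 - \<sigma>) * (\<Sum>i=1..k+1. B i)" using that by simp
  qed
  show ?thesis
    using v R0 summable_B_alpha gap step min_step unfolding R_def d_def by blast
qed

end
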